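(* Let $N\ge 2$ and $q\ge 1$ be integers and let $A$ be an $N\times N$ complex unitary matrix all of whose first-row entries equal $1/\sqrt N$. Let $(W_{n,A})_{n\ge 0}$ be the generalized Walsh functions associated to $A$. Assume $f:[0,1]\to\mathbb C$ is Lebesgue integrable and is constant on the interval $I=[i/N^q,(i+1)/N^q)$ for some $i\in\{0,1,\dots,N^q-1\}$. Then for all $x\in I$ $$f(x)=\sum_{n=0}^{N^q-1}\langle f, W_{n,A}\rangle W_{n,A}(x).$$
   Context: Generalized Walsh functions. Write $A=[a_{ij}]_{0\le i,j\le N-1}$, a complex unitary $N\times N$ matrix with $a_{0j}=1/\sqrt N$ for all $j$. For $0\le i\le N-1$ let $m_i(x)=\sqrt N\sum_{j=0}^{N-1}a_{ij}\chi_{[j/N,(j+1)/N)}(x)$ for $x\in[0,1)$, so $m_0\equiv 1$. Let $r(x)=(Nx)\bmod 1$, i.e. $r(x)=Nx-l$ for $x\in[l/N,(l+1)/N)$, $l\in\{0,\dots,N-1\}$. At the endpoint $x=1$ the convention is $r(1)=1$ and $m_i(1)=\sqrt N a_{i,N-1}$. For an integer $n\ge 0$ with base-$N$ expansion $n=\sum_{k=0}^{p-1}i_kN^k$, $i_k\in\{0,\dots,N-1\}$, set $$W_{n,A}(x)=m_{i_0}(x)\,m_{i_1}(r x)\cdots m_{i_{p-1}}(r^{p-1}x),$$ where $r^k$ is the $k$-fold iterate of $r$; $W_{0,A}\equiv1$. Functions are complex valued and $\langle f,g\rangle=\int_0^1 f(t)\overline{g(t)}\,dt$. *)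

theory Defs
  imports
    "HOL-Analysis.Analysis"
    "HOL-Library.Log_Nat"
    "Jordan_Normal_Form.Schur_Decomposition"
begin

definition unitary_mat :: "complex mat \<Rightarrow> bool" where
  "unitary_mat A \<longleftrightarrow>
     square_mat A \<and> inverts_mat A (mat_adjoint A) \<and> inverts_mat (mat_adjoint A) A"

text \<open>
  The functions below are meant to be used on the unit interval only; their values
  elsewhere are irrelevant. At the right endpoint, both \<open>walsh_shift\<close> and
  \<open>walsh_gen\<close> take their left limits.
\<close>

definition walsh_shift :: "nat \<Rightarrow> real \<Rightarrow> real" where
  "walsh_shift N x = (if x = 1 then 1 else frac (real N * x))"

definition walsh_gen :: "nat \<Rightarrow> complex mat \<Rightarrow> nat \<Rightarrow> real \<Rightarrow> complex" where
  "walsh_gen N A i x =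
     (if x = 1 then complex_of_real (sqrt (real N)) * A $$ (i, N - 1)
      else complex_of_real (sqrt (real N)) *
        (\<Sum>j<N. A $$ (i, j) * indicator {real j / real N ..< real (j + 1) / real N} x))"

text \<open>
  The number of digits of \<open>n\<close> in base \<open>N\<close> is \<open>floorlog N n\<close>, and its \<open>k\<close>-th digit is
  \<open>n div N ^ k mod N\<close>. Leading zeros do not matter, see \<open>walsh_expansion\<close> below.
\<close>

definition walsh :: "nat \<Rightarrow> complex mat \<Rightarrow> nat \<Rightarrow> real \<Rightarrow> complex" where
  "walsh N A n x =
     (\<Prod>k<floorlog N n. walsh_gen N A (n div N ^ k mod N) ((walsh_shift N ^^ k) x))"

definition walsh_inner :: "(real \<Rightarrow> complex) \<Rightarrow> (real \<Rightarrow> complex) \<Rightarrow> complex" where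
  "walsh_inner f g = (LINT t:{0..1}|lebesgue. f t * cnj (g t))"

lemma walsh_gen_eq:
  assumes "N > 0" "l < N" "real l / real N \<le> x" "x < real (l + 1) / real N"
  shows "walsh_gen N A i x = complex_of_real (sqrt (real N)) * A $$ (i, l)"
proof -
  have "real (l + 1) / real N \<le> 1"
    using assms by (simp add: field_simps)
  hence "x \<noteq> 1" using assms(4) by linarith
  have "indicator {real j / real N ..< real (j + 1) / real N} x = (if j = l then 1 else 0 :: complex)" for j
  proof (cases "j = l")
    case False
    have "\<not> (real j / real N \<le> x \<and> x < real (j + 1) / real N)"
    proof
      assume "real j / real N \<le> x \<and> x < real (j + 1) / real N"
      hence "real j \<le> x * N" "x * N < real (j + 1)" "real l \<le> x * N" "x * N < real (l + 1)"
        using assms by (auto simp: field_simps)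
      hence "real j < real (l + 1)" "real l < real (j + 1)" by linarith+
      thus False using False by linarith
    qed
    thus ?thesis using False by (auto simp: indicator_def)
  qed (use assms in auto)
  hence "(\<Sum>j<N. A $$ (i, j) * indicator {real j / real N ..< real (j + 1) / real N} x) =
      (\<Sum>j<N. if j = l then A $$ (i, j) else 0)"
    by (intro sum.cong) auto
  also have "\<dots> = A $$ (i, l)"
    using assms by simp
  finally show ?thesis using \<open>x \<noteq> 1\<close> by (simp add: walsh_gen_def)
qed

lemma walsh_gen_0:
  assumes "N > 0" "x \<in> {0..1}" "\<And>j. j < N \<Longrightarrow> A $$ (0, j) = 1 / complex_of_real (sqrt (real N))"
  shows "walsh_gen N A 0 x = 1"
proof (cases "x = 1")
  case True
  thus ?thesis using assms by (simp add: walsh_gen_def)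
next
  case False
  define l where "l = nat \<lfloor>real N * x\<rfloor>"
  have nn: "0 \<le> real N * x" "real N * x < real N" using assms False by auto
  hence l: "real l \<le> real N * x" "real N * x < real (l + 1)"
    unfolding l_def by linarith+
  hence "l < N" using nn by linarith
  have "real l / real N \<le> x" "x < real (l + 1) / real N"
    using l assms(1) by (auto simp: field_simps)
  from walsh_gen_eq[OF assms(1) \<open>l < N\<close> this, of A 0] show ?thesis
    using assms(1) assms(3)[OF \<open>l < N\<close>] by simp
qed

lemma walsh_shift_funpow_mem:
  assumes "x \<in> {0..1}"
  shows "(walsh_shift N ^^ k) x \<in> {0..1}"
  using assms by (induction k) (auto simp: walsh_shift_def frac_lt_1 less_imp_le)

lemma base_expansion_less:
  fixes N :: nat
  assumes "\<And>k. k < p \<Longrightarrow> d k < N"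
  shows "(\<Sum>k<p. d k * N ^ k) < N ^ p"
  using assms
proof (induction p)
  case (Suc p)
  have "(\<Sum>k<Suc p. d k * N ^ k) < N ^ p + d p * N ^ p"
    using Suc by simp
  also have "\<dots> = (d p + 1) * N ^ p" by simp
  also have "\<dots> \<le> N * N ^ p"
    using Suc.prems[of p] by (intro mult_right_mono) auto
  finally show ?case by simp
qed auto

lemma base_expansion_digit:
  fixes N :: nat
  assumes "\<And>k. k < p \<Longrightarrow> d k < N" "j < p"
  shows "(\<Sum>k<p. d k * N ^ k) div N ^ j mod N = d j"
  using assms
proof (induction j arbitrary: p d)
  case 0
  then obtain p' where p: "p = Suc p'" by (cases p) auto
  have "(\<Sum>k<p. d k * N ^ k) = d 0 + N * (\<Sum>k<p'. d (Suc k) * N ^ k)"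
    unfolding p by (subst sum.lessThan_Suc_shift) (simp add: sum_distrib_left mult_ac)
  thus ?case using 0 by simp
next
  case (Suc j)
  then obtain p' where p: "p = Suc p'" by (cases p) auto
  have "(\<Sum>k<p. d k * N ^ k) = d 0 + N * (\<Sum>k<p'. d (Suc k) * N ^ k)"
    unfolding p by (subst sum.lessThan_Suc_shift) (simp add: sum_distrib_left mult_ac)
  moreover have "d 0 < N" using Suc.prems p by auto
  ultimately have "(\<Sum>k<p. d k * N ^ k) div N = (\<Sum>k<p'. d (Suc k) * N ^ k)"
    by simp
  thus ?case using Suc.IH[of p' "\<lambda>k. d (Suc k)"] Suc.prems p
    by (simp add: div_mult2_eq)
qed

lemma walsh_expansion:
  assumes N: "N \<ge> 2"
    and row: "\<And>j. j < N \<Longrightarrow> A $$ (0, j) = 1 / complex_of_real (sqrt (real N))"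
    and d: "\<And>k. k < p \<Longrightarrow> d k < N" and n: "n = (\<Sum>k<p. d k * N ^ k)"
    and x: "x \<in> {0..1}"
  shows "walsh N A n x = (\<Prod>k<p. walsh_gen N A (d k) ((walsh_shift N ^^ k) x))"
proof -
  have "n < N ^ p" using base_expansion_less[of p d N] d n by simp
  have le: "floorlog N n \<le> p"
  proof (cases "n = 0")
    case False
    hence "N ^ (floorlog N n - 1) < N ^ p"
      using floorlog_bounds[of n N] N \<open>n < N ^ p\<close> by linarith
    hence "floorlog N n - 1 < p" using N by simp
    thus ?thesis by simp
  qed (simp add: floorlog_def)
  have high: "n div N ^ k mod N = 0" if "k \<ge> floorlog N n" for k
  proof (cases "n = 0")
    case False
    have "n < N ^ floorlog N n" using floorlog_bounds[of n N] False N by simp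
    also have "\<dots> \<le> N ^ k" using that N by (intro power_increasing) auto
    finally show ?thesis by simp
  qed simp
  have "walsh N A n x =
      (\<Prod>k<p. walsh_gen N A (n div N ^ k mod N) ((walsh_shift N ^^ k) x))"
    unfolding walsh_def using le N
    by (intro prod.mono_neutral_left)
       (auto simp: high intro!: walsh_gen_0[OF _ _ row] walsh_shift_funpow_mem[OF x])
  also have "\<dots> = (\<Prod>k<p. walsh_gen N A (d k) ((walsh_shift N ^^ k) x))"
    unfolding n by (intro prod.cong) (auto simp: base_expansion_digit[OF d])
  finally show ?thesis .
qed

end

theory Submission
  imports Defs
begin

text \<open>
  For \<open>n < N ^ q\<close> the Walsh functions are constant on the intervals
  \<open>[i / N ^ q, (i + 1) / N ^ q)\<close> with \<open>i < N ^ q\<close>, called the intervals of level \<open>q\<close>, and there are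
  as many functions as intervals. Summing the expansion under the integral sign
  turns the claim into a statement about the kernel
  \<open>K q x t = (\<Sum>n<N ^ q. cnj (W n t) * W n x)\<close>: it is \<open>N ^ q\<close> if \<open>x\<close> and \<open>t\<close> lie in the same
  interval of level \<open>q\<close>, and \<open>0\<close> otherwise, for \<open>x\<close> and \<open>t\<close> in
  \<open>[0, 1)\<close> (\<open>walsh_kernel\<close>). Integrating \<open>f\<close> against \<open>K q x\<close>
  therefore averages \<open>f\<close> over the interval containing \<open>x\<close>, which returns \<open>f x\<close> when \<open>f\<close> is
  constant there.

  The kernel is computed by induction on \<open>q\<close>. Splitting off the lowest digit of the index gives
  \<open>W (m * N + i) x = m\<^sub>i x * W m (r x)\<close> (\<open>walsh_digit_split\<close>), so that
  \<open>K (Suc q) x t = (\<Sum>i<N. cnj (m\<^sub>i t) * m\<^sub>i x) * K q (r x) (r t)\<close>. The first factor pairs two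
  columns of the unitary matrix \<open>A\<close>: it is \<open>N\<close> if \<open>x\<close> and \<open>t\<close> have the same leading base-\<open>N\<close>
  digit, and \<open>0\<close> otherwise.
\<close>

section \<open>Columns of a unitary matrix\<close>

lemma unitary_mat_col_orthonormal:
  assumes "A \<in> carrier_mat N N" "unitary_mat A" "j < N" "k < N"
  shows "(\<Sum>i<N. cnj (A $$ (i, j)) * A $$ (i, k)) = (if j = k then 1 else 0)"
proof -
  have dim: "dim_row A = N" "dim_col A = N" "dim_row (mat_adjoint A) = N"
    using assms(1) by (auto simp: mat_adjoint_def)
  have "mat_adjoint A * A = 1\<^sub>m N"
    using assms(2) dim by (simp add: unitary_mat_def inverts_mat_def)
  hence "(mat_adjoint A * A) $$ (j, k) = (if j = k then 1 else 0)"
    using assms(3,4) by simp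
  also have "(mat_adjoint A * A) $$ (j, k) = row (mat_adjoint A) j \<bullet> col A k"
    using assms(3,4) dim by simp
  also have "row (mat_adjoint A) j = conjugate (col A j)"
    using assms(3) dim unfolding mat_adjoint_def by (subst mat_of_rows_row) auto
  also have "conjugate (col A j) \<bullet> col A k = (\<Sum>i<N. cnj (A $$ (i, j)) * A $$ (i, k))"
    using assms(3,4) dim by (simp add: scalar_prod_def atLeast0LessThan)
  finally show ?thesis .
qed

section \<open>The Walsh kernel\<close>

lemma walsh_gen_eq_floor:
  assumes "N > 0" "x \<in> {0..<1}"
  shows "nat \<lfloor>real N * x\<rfloor> < N"
    and "walsh_gen N A i x = complex_of_real (sqrt (real N)) * A $$ (i, nat \<lfloor>real N * x\<rfloor>)"
proof -
  have nn: "0 \<le> real N * x" "real N * x < real N" using assms by auto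
  hence l: "real (nat \<lfloor>real N * x\<rfloor>) \<le> real N * x" "real N * x < real (nat \<lfloor>real N * x\<rfloor> + 1)"
    by linarith+
  thus less: "nat \<lfloor>real N * x\<rfloor> < N" using nn by linarith
  have "real (nat \<lfloor>real N * x\<rfloor>) / real N \<le> x" "x < real (nat \<lfloor>real N * x\<rfloor> + 1) / real N"
    using l assms(1) by (auto simp: field_simps)
  from walsh_gen_eq[OF assms(1) less this]
  show "walsh_gen N A i x = complex_of_real (sqrt (real N)) * A $$ (i, nat \<lfloor>real N * x\<rfloor>)" .
qed

text \<open>
  The case \<open>q = 1\<close> of the kernel formula: the generators at \<open>x\<close> and \<open>t\<close> are the columns of
  \<open>A\<close> selected by the leading digits, scaled by \<open>sqrt N\<close>.
\<close>
lemma walsh_gen_kernel: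
  assumes "N > 0" "A \<in> carrier_mat N N" "unitary_mat A" "x \<in> {0..<1}" "t \<in> {0..<1}"
  shows "(\<Sum>i<N. cnj (walsh_gen N A i t) * walsh_gen N A i x) =
           (if \<lfloor>real N * x\<rfloor> = \<lfloor>real N * t\<rfloor> then of_nat N else 0)"
proof -
  define a where "a = nat \<lfloor>real N * x\<rfloor>"
  define b where "b = nat \<lfloor>real N * t\<rfloor>"
  have a: "a < N" "\<And>i. walsh_gen N A i x = complex_of_real (sqrt (real N)) * A $$ (i, a)"
    using walsh_gen_eq_floor[OF assms(1,4)] by (auto simp: a_def)
  have b: "b < N" "\<And>i. walsh_gen N A i t = complex_of_real (sqrt (real N)) * A $$ (i, b)"
    using walsh_gen_eq_floor[OF assms(1,5)] by (auto simp: b_def)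
  have "(\<Sum>i<N. cnj (walsh_gen N A i t) * walsh_gen N A i x) =
      (\<Sum>i<N. (complex_of_real (sqrt (real N)) * complex_of_real (sqrt (real N))) *
              (cnj (A $$ (i, b)) * A $$ (i, a)))"
    by (intro sum.cong) (auto simp: a b mult_ac)
  also have "\<dots> = of_nat N * (\<Sum>i<N. cnj (A $$ (i, b)) * A $$ (i, a))"
    by (simp flip: sum_distrib_left of_real_mult)
  also have "\<dots> = (if b = a then of_nat N else 0)"
    using unitary_mat_col_orthonormal[OF assms(2,3) b(1) a(1)] by simp
  also have "b = a \<longleftrightarrow> \<lfloor>real N * x\<rfloor> = \<lfloor>real N * t\<rfloor>"
    using assms(4,5) unfolding a_def b_def by (auto simp: nat_eq_iff)
  finally show ?thesis .
qed

text \<open>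
  The lowest digit of the index governs the first factor, and the remaining digits are those of
  \<open>m\<close>, read along the orbit starting at \<open>r x\<close>. The index \<open>0\<close>, which has no digits at all, fits
  because the generator with index \<open>0\<close> is constantly \<open>1\<close>.
\<close>
lemma walsh_digit_split:
  assumes "N \<ge> 2" "i < N" "x \<in> {0..1}"
    and row: "\<And>j. j < N \<Longrightarrow> A $$ (0, j) = 1 / complex_of_real (sqrt (real N))"
  shows "walsh N A (m * N + i) x = walsh_gen N A i x * walsh N A m (walsh_shift N x)"
proof (cases "m * N + i = 0")
  case True
  hence "m = 0" "i = 0" using assms by auto
  moreover have "walsh_gen N A 0 x = 1"
    using walsh_gen_0[OF _ assms(3) row] assms(1) by simp
  ultimately show ?thesis by (simp add: walsh_def floorlog_def)
next
  case False
  have "(m * N + i) div N = m" using assms by simp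
  hence "floorlog N (m * N + i) = Suc (floorlog N m)"
    using False assms(1) by (subst compute_floorlog) simp
  moreover have "(m * N + i) div N ^ Suc k mod N = m div N ^ k mod N" for k
    using assms by (simp add: div_mult2_eq)
  ultimately show ?thesis
    using assms(2)
    by (simp add: walsh_def prod.lessThan_Suc_shift funpow_Suc_right
        del: power_Suc prod.lessThan_Suc funpow.simps(2))
qed

text \<open>
  Since \<open>\<lfloor>N ^ q * y\<rfloor>\<close> numbers the interval of level \<open>q\<close> containing \<open>y\<close>, this is the inductive
  step for lying in the same interval. The leading digit and the number of the shifted point are
  the quotient and the remainder of \<open>\<lfloor>N ^ Suc q * y\<rfloor>\<close> modulo \<open>N ^ q\<close>, hence determined by it.
\<close>
lemma floor_power_Suc_eq_iff:
  fixes x t :: real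
  assumes "N > 0"
  shows "\<lfloor>real N ^ Suc q * x\<rfloor> = \<lfloor>real N ^ Suc q * t\<rfloor> \<longleftrightarrow>
           \<lfloor>real N * x\<rfloor> = \<lfloor>real N * t\<rfloor> \<and>
           \<lfloor>real N ^ q * frac (real N * x)\<rfloor> = \<lfloor>real N ^ q * frac (real N * t)\<rfloor>"
proof -
  define M where "M = int (N ^ q)"
  have "M > 0" using assms by (simp add: M_def)
  have split: "\<lfloor>real N ^ Suc q * y\<rfloor> = \<lfloor>real N * y\<rfloor> * M + \<lfloor>real N ^ q * frac (real N * y)\<rfloor>" for y
  proof -
    have "real N ^ Suc q * y = of_int (\<lfloor>real N * y\<rfloor> * M) + real N ^ q * frac (real N * y)"
      by (simp add: frac_def M_def algebra_simps)
    thus ?thesis by (simp only: int_add_floor)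
  qed
  have rem: "0 \<le> \<lfloor>real N ^ q * frac (real N * y)\<rfloor> \<and> \<lfloor>real N ^ q * frac (real N * y)\<rfloor> < M" for y
  proof -
    have "real N ^ q * frac (real N * y) < real N ^ q * 1"
      using assms by (intro mult_strict_left_mono frac_lt_1) auto
    thus ?thesis by (auto simp: M_def floor_less_iff)
  qed
  have quot: "\<lfloor>real N ^ Suc q * y\<rfloor> div M = \<lfloor>real N * y\<rfloor>"
    and mod: "\<lfloor>real N ^ Suc q * y\<rfloor> mod M = \<lfloor>real N ^ q * frac (real N * y)\<rfloor>" for y
    using rem[of y] \<open>M > 0\<close> unfolding split by auto
  show ?thesis
    by (metis quot mod split)
qed

text \<open>
  The index block \<open>{m * N ..< m * N + N}\<close> contains the indices whose higher digits are those of
  \<open>m\<close>; grouping by blocks makes the double sum over \<open>m\<close> and the lowest digit factor.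
\<close>
lemma walsh_kernel:
  assumes "N \<ge> 2" "A \<in> carrier_mat N N" "unitary_mat A"
    and row: "\<And>j. j < N \<Longrightarrow> A $$ (0, j) = 1 / complex_of_real (sqrt (real N))"
    and "x \<in> {0..<1}" "t \<in> {0..<1}"
  shows "(\<Sum>n<N ^ q. cnj (walsh N A n t) * walsh N A n x) =
           (if \<lfloor>real N ^ q * x\<rfloor> = \<lfloor>real N ^ q * t\<rfloor> then of_nat (N ^ q) else 0)"
  using assms(5,6)
proof (induction q arbitrary: x t)
  case 0
  have "\<lfloor>x\<rfloor> = 0" "\<lfloor>t\<rfloor> = 0" using 0 by (auto simp: floor_eq_iff)
  thus ?case by (simp add: walsh_def floorlog_def)
next
  case (Suc q)
  let ?r = "walsh_shift N"
  have r: "?r x = frac (real N * x)" "?r t = frac (real N * t)"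
    using Suc.prems by (auto simp: walsh_shift_def)
  have "(\<Sum>n<N ^ Suc q. cnj (walsh N A n t) * walsh N A n x) =
      (\<Sum>m<N ^ q. \<Sum>n = m * N..<m * N + N. cnj (walsh N A n t) * walsh N A n x)"
    by (subst sum.nat_group) (simp add: mult.commute)
  also have "\<dots> = (\<Sum>m<N ^ q. \<Sum>i<N. cnj (walsh N A (m * N + i) t) * walsh N A (m * N + i) x)"
  proof (rule sum.cong[OF refl])
    fix m
    show "(\<Sum>n = m * N..<m * N + N. cnj (walsh N A n t) * walsh N A n x) =
        (\<Sum>i<N. cnj (walsh N A (m * N + i) t) * walsh N A (m * N + i) x)"
      using sum.shift_bounds_nat_ivl[of "\<lambda>n. cnj (walsh N A n t) * walsh N A n x" 0 "m * N" N]
      by (simp add: atLeast0LessThan add.commute)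
  qed
  also have "\<dots> = (\<Sum>m<N ^ q. \<Sum>i<N. (cnj (walsh N A m (?r t)) * walsh N A m (?r x)) *
      (cnj (walsh_gen N A i t) * walsh_gen N A i x))"
    using Suc.prems
    by (intro sum.cong refl) (simp add: walsh_digit_split[OF assms(1) _ _ row] mult_ac)
  also have "\<dots> = (\<Sum>m<N ^ q. cnj (walsh N A m (?r t)) * walsh N A m (?r x)) *
      (\<Sum>i<N. cnj (walsh_gen N A i t) * walsh_gen N A i x)"
    by (simp add: sum_product)
  also have "(\<Sum>m<N ^ q. cnj (walsh N A m (?r t)) * walsh N A m (?r x)) =
      (if \<lfloor>real N ^ q * frac (real N * x)\<rfloor> = \<lfloor>real N ^ q * frac (real N * t)\<rfloor>
       then of_nat (N ^ q) else 0)"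
    unfolding r by (rule Suc.IH) (auto simp: frac_lt_1)
  also have "(\<Sum>i<N. cnj (walsh_gen N A i t) * walsh_gen N A i x) =
      (if \<lfloor>real N * x\<rfloor> = \<lfloor>real N * t\<rfloor> then of_nat N else 0)"
    using assms(1-3) Suc.prems by (intro walsh_gen_kernel) auto
  finally show ?case
    using assms(1) by (subst floor_power_Suc_eq_iff) auto
qed

section \<open>Integrability against Walsh functions\<close>

lemma walsh_measurable [measurable]: "walsh N A n \<in> borel_measurable borel"
proof -
  have gen [measurable]: "walsh_gen N A i \<in> borel_measurable borel" for i
    unfolding walsh_gen_def by measurable
  have [measurable]: "walsh_shift N \<in> borel_measurable borel"
    unfolding walsh_shift_def frac_def by measurable
  have [measurable]: "(walsh_shift N ^^ k) \<in> borel_measurable borel" for k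
    by (induction k) (auto simp: comp_def)
  show ?thesis unfolding walsh_def by measurable
qed

lemma walsh_bounded: "\<exists>B. \<forall>x. norm (walsh N A n x) \<le> B"
proof -
  have "\<exists>B. \<forall>x. norm (walsh_gen N A i x) \<le> B" for i
  proof (intro exI allI)
    fix x :: real
    have "norm (\<Sum>j<N. A $$ (i, j) * indicator {real j / real N ..< real (j + 1) / real N} x)
        \<le> (\<Sum>j<N. norm (A $$ (i, j)))"
      by (intro sum_norm_le) (auto simp: indicator_def)
    hence "norm (\<Sum>j<N. A $$ (i, j) * indicator {real j / real N ..< real (j + 1) / real N} x)
        \<le> (\<Sum>j<N. norm (A $$ (i, j))) + norm (A $$ (i, N - 1))"
      using norm_ge_zero[of "A $$ (i, N - 1)"] by linarith
    moreover have "norm (A $$ (i, N - 1)) \<le> (\<Sum>j<N. norm (A $$ (i, j))) + norm (A $$ (i, N - 1))"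
      by (simp add: sum_nonneg)
    ultimately show "norm (walsh_gen N A i x) \<le>
        sqrt (real N) * ((\<Sum>j<N. norm (A $$ (i, j))) + norm (A $$ (i, N - 1)))"
      unfolding walsh_gen_def by (auto simp: norm_mult intro!: mult_left_mono)
  qed
  then obtain B where B: "\<And>i x. norm (walsh_gen N A i x) \<le> B i" by metis
  have "norm (walsh N A n x) \<le> (\<Prod>k<floorlog N n. B (n div N ^ k mod N))" for x
    unfolding walsh_def prod_norm[symmetric] by (intro prod_mono) (auto simp: B)
  thus ?thesis by blast
qed

text \<open>
  This justifies exchanging the finite sum over \<open>n\<close> with the integral. It holds because a Walsh
  function is Borel measurable and bounded.
\<close>
lemma set_integrable_mult_cnj_walsh:
  assumes "set_integrable lebesgue {0..1} f"
  shows "set_integrable lebesgue {0..1} (\<lambda>t. f t * cnj (walsh N A n t))"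
proof -
  obtain B where B: "\<And>x. norm (walsh N A n x) \<le> B" using walsh_bounded by blast
  have f: "integrable lebesgue (\<lambda>t. indicator {0..1} t *\<^sub>R f t)"
    using assms by (simp add: set_integrable_def)
  have meas: "(\<lambda>t. cnj (walsh N A n t)) \<in> borel_measurable lebesgue"
    by (intro measurable_completion)
       (simp add: borel_measurable_continuous_on[OF continuous_on_cnj[OF continuous_on_id]])
  have "integrable lebesgue (\<lambda>t. (indicator {0..1} t *\<^sub>R f t) * cnj (walsh N A n t))"
  proof (rule Bochner_Integration.integrable_bound)
    show "integrable lebesgue (\<lambda>t. B *\<^sub>R (indicator {0..1} t *\<^sub>R f t))"
      using f by (rule integrable_scaleR_right)
    show "(\<lambda>t. (indicator {0..1} t *\<^sub>R f t) * cnj (walsh N A n t)) \<in> borel_measurable lebesgue"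
      using f meas by (intro borel_measurable_times) auto
    show "AE t in lebesgue. norm ((indicator {0..1} t *\<^sub>R f t) * cnj (walsh N A n t))
        \<le> norm (B *\<^sub>R (indicator {0..1} t *\<^sub>R f t))"
    proof (rule AE_I2)
      fix t
      have "norm (walsh N A n t) \<le> \<bar>B\<bar>" using B[of t] by linarith
      hence "norm (f t) * norm (walsh N A n t) \<le> \<bar>B\<bar> * norm (f t)"
        using mult_right_mono[of "norm (walsh N A n t)" "\<bar>B\<bar>" "norm (f t)"]
        by (simp add: mult.commute)
      thus "norm ((indicator {0..1} t *\<^sub>R f t) * cnj (walsh N A n t))
          \<le> norm (B *\<^sub>R (indicator {0..1} t *\<^sub>R f t))"
        by (simp add: norm_mult indicator_def)
    qed
  qed
  thus ?thesis by (simp add: set_integrable_def)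
qed

section \<open>The Walsh expansion\<close>

lemma mem_Nadic_interval_iff:
  fixes y :: real
  assumes "N > 0"
  shows "y \<in> {real i / real N ^ q ..< real (i + 1) / real N ^ q} \<longleftrightarrow> \<lfloor>real N ^ q * y\<rfloor> = int i"
  using assms by (auto simp: floor_eq_iff field_simps)

theorem corollary2p3:
  fixes N q i :: nat and A :: "complex mat" and f :: "real \<Rightarrow> complex"
  assumes "N \<ge> 2" and "q \<ge> 1"
    and "A \<in> carrier_mat N N" and "unitary_mat A"
    and "\<And>j. j < N \<Longrightarrow> A $$ (0, j) = 1 / complex_of_real (sqrt (real N))"
    and "set_integrable lebesgue {0..1} f"
    and "i < N ^ q"
    and "f constant_on {real i / real N ^ q ..< real (i + 1) / real N ^ q}"
  shows "\<forall>x \<in> {real i / real N ^ q ..< real (i + 1) / real N ^ q}.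
           f x = (\<Sum>n<N ^ q. walsh_inner f (walsh N A n) * walsh N A n x)"
proof
  let ?I = "{real i / real N ^ q ..< real (i + 1) / real N ^ q}"
  fix x assume x: "x \<in> ?I"
  have N0: "N > 0" using assms(1) by simp
  have "real (i + 1) \<le> real (N ^ q)" using assms(7) by (intro of_nat_mono) simp
  hence top: "real (i + 1) / real N ^ q \<le> 1" using N0 by (simp add: field_simps)
  have bot: "0 \<le> real i / real N ^ q" by simp
  have le: "real i / real N ^ q \<le> (1 + real i) / real N ^ q"
    by (simp add: divide_right_mono)
  have I01: "?I \<subseteq> {0..<1}" using top bot by (auto simp: less_le_trans order_trans[OF bot])
  hence x01: "x \<in> {0..<1}" using x by blast
  have kernel: "(\<Sum>n<N ^ q. cnj (walsh N A n t) * walsh N A n x) =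
      of_nat (N ^ q) * indicator ?I t" if "t \<in> {0..<1}" for t
  proof -
    have same: "\<lfloor>real N ^ q * x\<rfloor> = \<lfloor>real N ^ q * t\<rfloor> \<longleftrightarrow> t \<in> ?I"
      using x mem_Nadic_interval_iff[OF N0, of _ i q] by metis
    have "(\<Sum>n<N ^ q. cnj (walsh N A n t) * walsh N A n x) =
        (if \<lfloor>real N ^ q * x\<rfloor> = \<lfloor>real N ^ q * t\<rfloor> then of_nat (N ^ q) else 0)"
      by (rule walsh_kernel[OF assms(1,3,4) _ x01 that]) (rule assms(5))
    also have "\<dots> = of_nat (N ^ q) * indicator ?I t"
      unfolding same indicator_def by simp
    finally show ?thesis .
  qed
  have "(\<Sum>n<N ^ q. walsh_inner f (walsh N A n) * walsh N A n x) =
      (\<Sum>n<N ^ q. LINT t|lebesgue.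
        (indicator {0..1} t *\<^sub>R (f t * cnj (walsh N A n t))) * walsh N A n x)"
    by (simp only: walsh_inner_def set_lebesgue_integral_def integral_mult_left_zero)
  also have "\<dots> = (LINT t|lebesgue. (\<Sum>n<N ^ q.
        (indicator {0..1} t *\<^sub>R (f t * cnj (walsh N A n t))) * walsh N A n x))"
    using set_integrable_mult_cnj_walsh[OF assms(6)]
    by (intro Bochner_Integration.integral_sum[symmetric] integrable_mult_left)
       (simp add: set_integrable_def)
  also have "\<dots> = (LINT t|lebesgue. indicator {0..1} t *\<^sub>R
        (f t * (\<Sum>n<N ^ q. cnj (walsh N A n t) * walsh N A n x)))"
    by (intro Bochner_Integration.integral_cong refl)
       (simp add: sum_distrib_left scaleR_sum_right mult.assoc)
  also have "\<dots> = (LINT t|lebesgue. indicator ?I t *\<^sub>R (of_nat (N ^ q) * f x))"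
    \<comment> \<open>The kernel formula covers the half-open unit interval; the point \<open>1\<close> is a null set.\<close>
  proof (rule integral_discrete_difference[where X = "{1}"])
    fix t :: real assume "t \<notin> {1}"
    show "indicator {0..1} t *\<^sub>R (f t * (\<Sum>n<N ^ q. cnj (walsh N A n t) * walsh N A n x)) =
        indicator ?I t *\<^sub>R (of_nat (N ^ q) * f x)"
    proof (cases "t \<in> {0..<1}")
      case True
      have "f t = f x" if "t \<in> ?I"
        using assms(8) x that unfolding constant_on_def by auto
      thus ?thesis using True by (auto simp: kernel[OF True] indicator_def)
    next
      case False
      hence "t \<notin> {0..1}" using \<open>t \<notin> {1}\<close> by auto
      moreover have "t \<notin> ?I" using False I01 by blast
      ultimately show ?thesis by simp
    qed
  qed auto
  also have "\<dots> = measure lebesgue ?I *\<^sub>R (of_nat (N ^ q) * f x)"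
    by (subst integral_scaleR_left) (auto simp: integrable_indicator_iff le)
  also have "measure lebesgue ?I = 1 / real N ^ q"
    using le by (simp flip: diff_divide_distrib)
  also have "(1 / real N ^ q) *\<^sub>R (of_nat (N ^ q) * f x) = f x"
    using N0 by (simp add: scaleR_conv_of_real)
  finally show "f x = (\<Sum>n<N ^ q. walsh_inner f (walsh N A n) * walsh N A n x)" ..
qed

end
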